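(* Let $(G,\Gamma)$ be a $d$-periodic graph with $n=|V/\Gamma|$. Fix representatives $v_0,\dots,v_{n-1}$ of the $\Gamma$-orbits on $V$ and an isomorphism $\mathbb{Z}^d\approx\Gamma$. Then all periodic placements of $(G,\Gamma)$ in $\mathbb{R}^d$, up to equivalence under the group $E(d)$ of Euclidean isometries, are parametrized by $(\mathbb{R}^d)^{n-1}\times\Omega(d)$, which is an open set of $\mathbb{R}^{dn+\binom{d}{2}}$. That is, the map $$(p,\pi)\mapsto(t_1,\dots,t_{n-1},\omega),\qquad t_i=\Lambda^{-1}(p(v_i)-p(v_0)),\quad \omega=\Lambda^t\Lambda,$$ where $\Lambda\in GL(d,\mathbb{R})$ is the matrix with columns $\pi(e_1),\dots,\pi(e_d)$, induces a bijection from the set of $E(d)$-equivalence classes of periodic placements of $(G,\Gamma)$ onto $(\mathbb{R}^d)^{n-1}\times\Omega(d)$.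
   Context: A $d$-periodic graph $(G,\Gamma)$ consists of an infinite connected graph $G=(V,E)$ and a free Abelian group $\Gamma\subset Aut(G)$ of rank $d$, acting freely on $V$, such that the quotient multigraph $G/\Gamma$ is finite. A periodic placement $(p,\pi)$ of $(G,\Gamma)$ in $\mathbb{R}^d$ consists of a function $p:V\to\mathbb{R}^d$ and an injective homomorphism $\pi:\Gamma\to\mathcal{T}(\mathbb{R}^d)$ into the group of translations of $\mathbb{R}^d$ (identified with $\mathbb{R}^d$ via translation vectors), whose image is a lattice of rank $d$, such that $p\circ\gamma=\pi(\gamma)\circ p$ for all $\gamma\in\Gamma$. The group $E(d)$ of isometries of $\mathbb{R}^d$ acts on placements by $u\cdot(p,\pi)=(u\circ p,\,U\pi)$ for $u(x)=Ux+t$, $U\in O(d,\mathbb{R})$, $t\in\mathbb{R}^d$, where $(U\pi)(\gamma)$ is the translation by $U$ applied to the translation vector of $\pi(\gamma)$. $e_1,\dots,e_d$ is the standard basis of $\mathbb{Z}^d\approx\Gamma$. $\Omega(d)$ is the open cone of real symmetric $d\times d$ matrices with positive eigenvalues, viewed as an open subset of the $\binom{d+1}{2}$-dimensional vector space of real symmetric $d\times d$ matrices. The superscript $t$ on a matrix denotes transpose. *)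

theory Defs
  imports
    "HOL-Analysis.Analysis"
    "HOL-Algebra.Bij"
    "HOL-Algebra.Group_Action"
    "HOL-Algebra.Free_Abelian_Groups"
begin

definition simple_graph :: "'v set \<Rightarrow> 'v set set \<Rightarrow> bool" where
  "simple_graph V E \<longleftrightarrow> (\<forall>e\<in>E. \<exists>u\<in>V. \<exists>w\<in>V. u \<noteq> w \<and> e = {u, w})"

definition connected_graph :: "'v set \<Rightarrow> 'v set set \<Rightarrow> bool" where
  "connected_graph V E \<longleftrightarrow> (\<forall>u\<in>V. \<forall>w\<in>V. (u, w) \<in> {(x, y). {x, y} \<in> E}\<^sup>*)"

text \<open>As in \<^const>\<open>BijGroup\<close>, automorphisms are functions that are \<^const>\<open>undefined\<close> off \<open>V\<close>.\<close>

definition graph_automorphisms :: "'v set \<Rightarrow> 'v set set \<Rightarrow> ('v \<Rightarrow> 'v) set" where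
  "graph_automorphisms V E =
     {f \<in> Bij V. \<forall>u\<in>V. \<forall>w\<in>V. {f u, f w} \<in> E \<longleftrightarrow> {u, w} \<in> E}"

abbreviation perm_group :: "'v set \<Rightarrow> ('v \<Rightarrow> 'v) set \<Rightarrow> ('v \<Rightarrow> 'v) monoid" where
  "perm_group V \<Gamma> \<equiv> (BijGroup V)\<lparr>carrier := \<Gamma>\<rparr>"

definition vertex_orbits :: "'v set \<Rightarrow> ('v \<Rightarrow> 'v) set \<Rightarrow> 'v set set" where
  "vertex_orbits V \<Gamma> = orbits (perm_group V \<Gamma>) V (\<lambda>\<gamma>. \<gamma>)"

definition edge_orbits :: "'v set \<Rightarrow> 'v set set \<Rightarrow> ('v \<Rightarrow> 'v) set \<Rightarrow> 'v set set set" where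
  "edge_orbits V E \<Gamma> = orbits (perm_group V \<Gamma>) E (\<lambda>\<gamma> e. \<gamma> ` e)"

definition periodic_graph :: "nat \<Rightarrow> 'v set \<Rightarrow> 'v set set \<Rightarrow> ('v \<Rightarrow> 'v) set \<Rightarrow> bool" where
  "periodic_graph d V E \<Gamma> \<longleftrightarrow>
     simple_graph V E \<and> infinite V \<and> connected_graph V E \<and>
     subgroup \<Gamma> (BijGroup V) \<and> \<Gamma> \<subseteq> graph_automorphisms V E \<and>
     perm_group V \<Gamma> \<cong> free_Abelian_group {..<d} \<and>
     (\<forall>\<gamma>\<in>\<Gamma>. \<forall>x\<in>V. \<gamma> x = x \<longrightarrow> \<gamma> = \<one>\<^bsub>BijGroup V\<^esub>) \<and>
     finite (vertex_orbits V \<Gamma>) \<and> finite (edge_orbits V E \<Gamma>)"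

text \<open>The orbit representatives are \<open>v 0, \<dots>, v (n - 1)\<close>; other values of \<open>v\<close> are irrelevant.\<close>

definition orbit_representatives ::
  "'v set \<Rightarrow> ('v \<Rightarrow> 'v) set \<Rightarrow> nat \<Rightarrow> (nat \<Rightarrow> 'v) \<Rightarrow> bool" where
  "orbit_representatives V \<Gamma> n v \<longleftrightarrow>
     v ` {..<n} \<subseteq> V \<and>
     bij_betw (\<lambda>i. orbit (perm_group V \<Gamma>) (\<lambda>\<gamma>. \<gamma>) (v i)) {..<n} (vertex_orbits V \<Gamma>)"

text \<open>A translation is represented by its translation vector.\<close>

definition translation_group :: "(real ^ 'd) monoid" where
  "translation_group = \<lparr>carrier = UNIV, mult = (+), one = 0\<rparr>"

definition lattice_of_rank :: "nat \<Rightarrow> (real ^ 'd) set \<Rightarrow> bool" where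
  "lattice_of_rank k L \<longleftrightarrow>
     (\<exists>B. finite B \<and> independent B \<and> card B = k \<and>
          L = {\<Sum>b\<in>B. of_int (c b) *\<^sub>R b | c :: real ^ 'd \<Rightarrow> int. True})"

type_synonym ('v, 'd) placement = "('v \<Rightarrow> real ^ 'd) \<times> (('v \<Rightarrow> 'v) \<Rightarrow> real ^ 'd)"

text \<open>Extensionality makes equality of pairs coincide with equality of placements as
  functions on \<open>V\<close> and on \<open>\<Gamma>\<close>.\<close>

definition periodic_placements ::
  "'v set \<Rightarrow> ('v \<Rightarrow> 'v) set \<Rightarrow> ('v, 'd::finite) placement set" where
  "periodic_placements V \<Gamma> =
     {(p, \<pi>). p \<in> extensional V \<and> \<pi> \<in> extensional \<Gamma> \<and>
        \<pi> \<in> mon (perm_group V \<Gamma>) translation_group \<and>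
        lattice_of_rank CARD('d) (\<pi> ` \<Gamma>) \<and>
        (\<forall>\<gamma>\<in>\<Gamma>. \<forall>x\<in>V. p (\<gamma> x) = p x + \<pi> \<gamma>)}"

definition isometry_action ::
  "'v set \<Rightarrow> ('v \<Rightarrow> 'v) set \<Rightarrow> real ^ 'd ^ 'd \<Rightarrow> real ^ 'd
     \<Rightarrow> ('v, 'd::finite) placement \<Rightarrow> ('v, 'd) placement" where
  "isometry_action V \<Gamma> U t = (\<lambda>(p, \<pi>). (\<lambda>x\<in>V. U *v p x + t, \<lambda>\<gamma>\<in>\<Gamma>. U *v \<pi> \<gamma>))"

definition placement_equiv ::
  "'v set \<Rightarrow> ('v \<Rightarrow> 'v) set \<Rightarrow> (('v, 'd::finite) placement \<times> ('v, 'd) placement) set" where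
  "placement_equiv V \<Gamma> =
     {(P, Q). P \<in> periodic_placements V \<Gamma> \<and> Q \<in> periodic_placements V \<Gamma> \<and>
        (\<exists>U t. orthogonal_matrix U \<and> Q = isometry_action V \<Gamma> U t P)}"

text \<open>Here \<open>\<phi>\<close> is the chosen isomorphism from the free abelian group on the index type
  \<open>'d\<close> onto \<open>\<Gamma>\<close>, and \<open>frag_of j\<close> is the standard basis vector with index \<open>j\<close>.\<close>

definition lattice_matrix ::
  "(('d \<Rightarrow>\<^sub>0 int) \<Rightarrow> 'v \<Rightarrow> 'v) \<Rightarrow> (('v \<Rightarrow> 'v) \<Rightarrow> real ^ 'd) \<Rightarrow> real ^ 'd ^ 'd::finite" where
  "lattice_matrix \<phi> \<pi> = (\<chi> i j. \<pi> (\<phi> (frag_of j)) $ i)"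

definition placement_parameters ::
  "(('d \<Rightarrow>\<^sub>0 int) \<Rightarrow> 'v \<Rightarrow> 'v) \<Rightarrow> nat \<Rightarrow> (nat \<Rightarrow> 'v) \<Rightarrow> ('v, 'd::finite) placement
     \<Rightarrow> (nat \<Rightarrow> real ^ 'd) \<times> (real ^ 'd ^ 'd)" where
  "placement_parameters \<phi> n v = (\<lambda>(p, \<pi>).
     let \<Lambda> = lattice_matrix \<phi> \<pi> in
     (\<lambda>i\<in>{1..<n}. matrix_inv \<Lambda> *v (p (v i) - p (v 0)), transpose \<Lambda> ** \<Lambda>))"

definition symmetric_matrices :: "(real ^ 'd ^ 'd) set" where
  "symmetric_matrices = {A. transpose A = A}"

definition eigenvalue_of :: "real ^ 'd ^ 'd \<Rightarrow> real \<Rightarrow> bool" where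
  "eigenvalue_of A c \<longleftrightarrow> (\<exists>x. x \<noteq> 0 \<and> A *v x = c *\<^sub>R x)"

text \<open>All complex eigenvalues of a real symmetric matrix are real, so real ones suffice.\<close>

definition Omega :: "(real ^ 'd ^ 'd) set" where
  "Omega = {A \<in> symmetric_matrices. \<forall>c. eigenvalue_of A c \<longrightarrow> c > 0}"

text \<open>An element of the \<open>(n - 1)\<close>-fold power of \<open>\<real>\<^sup>d\<close> is an extensional function on
  \<open>{1..<n}\<close>.\<close>

definition parameter_space :: "nat \<Rightarrow> ((nat \<Rightarrow> real ^ 'd) \<times> (real ^ 'd ^ 'd)) set" where
  "parameter_space n = ({1..<n} \<rightarrow>\<^sub>E UNIV) \<times> Omega"

text \<open>The vector space of pairs of such a function and a symmetric matrix, with its usual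
  topology and its linear combinations.\<close>

definition ambient_topology ::
  "nat \<Rightarrow> ((nat \<Rightarrow> real ^ 'd) \<times> (real ^ 'd ^ 'd)) topology" where
  "ambient_topology n =
     prod_topology (product_topology (\<lambda>_. euclidean) {1..<n}) (top_of_set symmetric_matrices)"

definition ambient_lincomb ::
  "nat \<Rightarrow> real \<Rightarrow> (nat \<Rightarrow> real ^ 'd) \<times> (real ^ 'd ^ 'd) \<Rightarrow> real
     \<Rightarrow> (nat \<Rightarrow> real ^ 'd) \<times> (real ^ 'd ^ 'd) \<Rightarrow> (nat \<Rightarrow> real ^ 'd) \<times> (real ^ 'd ^ 'd)" where
  "ambient_lincomb n a x b y =
     (\<lambda>i\<in>{1..<n}. a *\<^sub>R fst x i + b *\<^sub>R fst y i, a *\<^sub>R snd x + b *\<^sub>R snd y)"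

text \<open>A linear homeomorphism onto \<open>\<real>\<^sup>N\<close>.\<close>

definition linear_identification ::
  "nat \<Rightarrow> nat \<Rightarrow> ((nat \<Rightarrow> real ^ 'd) \<times> (real ^ 'd ^ 'd) \<Rightarrow> nat \<Rightarrow> real) \<Rightarrow> bool" where
  "linear_identification n N \<Phi> \<longleftrightarrow>
     homeomorphic_map (ambient_topology n) (Euclidean_space N) \<Phi> \<and>
     (\<forall>x\<in>topspace (ambient_topology n). \<forall>y\<in>topspace (ambient_topology n). \<forall>a b.
        \<Phi> (ambient_lincomb n a x b y) = (\<lambda>k. a * \<Phi> x k + b * \<Phi> y k))"

end

(* A placement is determined by the matrix \<Lambda> of the images of the basis of \<Gamma> together with the
   positions of the orbit representatives, and by freeness of the action these can be prescribed
   arbitrarily, subject to \<Lambda> being invertible. Two matrices \<Lambda>, M have the same Gram matrix exactly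
   when M = U \<Lambda> with U orthogonal, and every element of \<Omega>(d) is a Gram matrix, which gives the
   bijection. Openness of \<Omega>(d) among the symmetric matrices follows from the lower bound
   x . A x >= c |x|^2, with c > 0 the least eigenvalue of A. *)

theory Submission
  imports Defs
begin

subsection \<open>Positive definite matrices\<close>

text \<open>An isometry with linear part U turns \<Lambda> into U \<Lambda> and p(v_i) - p(v_0) into
  U (p(v_i) - p(v_0)). Measuring the differences in the lattice basis, through the inverse of
  \<Lambda>, cancels U, as does forming \<Lambda>^t \<Lambda>; translations cancel in the
  differences. So the parameters are invariants. \<open>Omega\<close> is defined by eigenvalues,
  while the arguments need positivity of x . A x. The bridge is that the minimum of this form on the
  unit sphere is an eigenvalue. For the Gram factorization, a basis orthonormal for x . A y gives a
  matrix P with P^t A P = 1, and L = P^-1 then satisfies L^t L = A. Invertibility of \<Lambda> is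
  the matrix form of the requirement that the periods form a lattice of rank d. The exponent is the
  count (n - 1) d + d (d + 1) / 2 = d n + (d choose 2).\<close>

lemma norm_matrix_vector_le: "norm (A *v x) \<le> norm A * norm x" for A :: "real ^ 'n ^ 'm"
proof -
  \<comment> \<open>Cauchy-Schwarz row by row; \<open>norm A\<close> is the L2 norm of the row
    norms, that is, the Frobenius norm.\<close>
  have "\<bar>(A *v x) $ i\<bar> \<le> norm (A $ i) * norm x" for i
    using Cauchy_Schwarz_ineq2[of "A $ i" x]
    by (simp add: matrix_vector_mult_def inner_vec_def)
  then have "norm (A *v x) \<le> L2_set (\<lambda>i. norm (A $ i) * norm x) UNIV"
    unfolding norm_vec_def[of "A *v x"] by (intro L2_set_mono) auto
  also have "\<dots> = norm A * norm x"
    by (simp add: L2_set_left_distrib norm_vec_def[of A])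
  finally show ?thesis .
qed

lemma symmetric_inner_commute:
  fixes A :: "real ^ 'n ^ 'n"
  assumes "transpose A = A"
  shows "x \<bullet> (A *v y) = y \<bullet> (A *v x)"
  by (metis assms dot_lmul_matrix inner_commute transpose_matrix_vector)

text \<open>The minimum of the quadratic form on the unit sphere is attained at an eigenvector.\<close>

lemma symmetric_least_eigenvalue:
  fixes A :: "real ^ 'n ^ 'n"
  assumes sym: "transpose A = A"
  obtains c where "eigenvalue_of A c" "\<And>x. c * (x \<bullet> x) \<le> x \<bullet> (A *v x)"
proof -
  have "sphere (0 :: real ^ 'n) 1 \<noteq> {}"
    by simp
  moreover have "continuous_on (sphere 0 1) (\<lambda>x. x \<bullet> (A *v x))"
    by (intro continuous_intros linear_continuous_on matrix_vector_mul_bounded_linear)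
  ultimately obtain u where "u \<in> sphere 0 1"
    and "\<forall>y\<in>sphere 0 1. u \<bullet> (A *v u) \<le> y \<bullet> (A *v y)"
    using continuous_attains_inf[OF compact_sphere] by blast
  then have u: "norm u = 1"
    and umin: "\<And>y. norm y = 1 \<Longrightarrow> u \<bullet> (A *v u) \<le> y \<bullet> (A *v y)"
    by auto
  define c where "c = u \<bullet> (A *v u)"
  have uu: "u \<bullet> u = 1"
    using u by (simp add: dot_square_norm)
  have le: "c * (x \<bullet> x) \<le> x \<bullet> (A *v x)" for x
  proof (cases "x = 0")
    case False
    have "c \<le> (x /\<^sub>R norm x) \<bullet> (A *v (x /\<^sub>R norm x))"
      using False unfolding c_def by (intro umin) simp
    also have "\<dots> = (x \<bullet> (A *v x)) / (x \<bullet> x)"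
      by (simp add: matrix_vector_mult_scaleR dot_square_norm power2_eq_square field_simps)
    finally show ?thesis
      using False by (simp add: field_simps)
  qed simp
  \<comment> \<open>\<open>y\<close> is the defect in the eigenvector equation. The form x . A x - c
    (x . x) is nonnegative and vanishes at \<open>u\<close>; its values along the line u + s y will
    force y = 0.\<close>
  define y where "y = A *v u - c *\<^sub>R u"
  define q where "q = y \<bullet> (A *v y) - c * (y \<bullet> y)"
  have q: "q \<ge> 0"
    using le[of y] by (simp add: q_def)
  have quad: "2 * s * (y \<bullet> y) + s\<^sup>2 * q \<ge> 0" for s
  proof -
    have yAu: "y \<bullet> (A *v u) = y \<bullet> y + c * (y \<bullet> u)"
      by (simp add: y_def inner_diff_left inner_diff_right algebra_simps)
    have "(u + s *\<^sub>R y) \<bullet> (A *v (u + s *\<^sub>R y)) - c * ((u + s *\<^sub>R y) \<bullet> (u + s *\<^sub>R y))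
        = 2 * s * (y \<bullet> y) + s\<^sup>2 * q"
      unfolding q_def
      by (simp add: matrix_vector_mult_scaleR matrix_vector_right_distrib inner_add_left
          inner_add_right symmetric_inner_commute[OF sym, of u y] uu inner_commute[of u y]
          yAu c_def[symmetric] power2_eq_square algebra_simps)
    with le[of "u + s *\<^sub>R y"] show ?thesis
      by simp
  qed
  have "y \<bullet> y = 0"
  proof (rule ccontr)
    assume "y \<bullet> y \<noteq> 0"
    then have Y: "y \<bullet> y > 0"
      by simp
    \<comment> \<open>With r = q + 1 the choice s = -(y . y) / r is legitimate even if q = 0, and
      the linear term of \<open>quad\<close> outweighs the quadratic one.\<close>
    define r where "r = q + 1"
    have r: "r > 0"
      using q by (simp add: r_def)
    have q_r: "q = r - 1"
      by (simp add: r_def)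
    have "2 * (- (y \<bullet> y) / r) * (y \<bullet> y) + (- (y \<bullet> y) / r)\<^sup>2 * q
        = - ((y \<bullet> y)\<^sup>2 * (r + 1) / r\<^sup>2)"
      using r by (simp add: q_r power2_eq_square divide_simps)
        (simp add: algebra_simps)
    moreover have "(y \<bullet> y)\<^sup>2 * (r + 1) / r\<^sup>2 > 0"
      using r Y by (intro divide_pos_pos mult_pos_pos) auto
    ultimately show False
      using quad[of "- (y \<bullet> y) / r"] by linarith
  qed
  then have "eigenvalue_of A c"
    unfolding eigenvalue_of_def using u by (intro exI[of _ u]) (auto simp: y_def)
  with le that show ?thesis
    by blast
qed

text \<open>The least eigenvalue bounds the quadratic form from below, which gives one direction;
  evaluating the form at an eigenvector gives the other.\<close>

lemma Omega_iff:
  fixes A :: "real ^ 'n ^ 'n"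
  shows "A \<in> Omega \<longleftrightarrow> transpose A = A \<and> (\<forall>x. x \<noteq> 0 \<longrightarrow> x \<bullet> (A *v x) > 0)"
proof (intro iffI conjI allI impI)
  fix x :: "real ^ 'n" assume A: "A \<in> Omega" and "x \<noteq> 0"
  then obtain c where "c > 0" "c * (x \<bullet> x) \<le> x \<bullet> (A *v x)"
    unfolding Omega_def symmetric_matrices_def
    by (metis (mono_tags, lifting) mem_Collect_eq symmetric_least_eigenvalue)
  with \<open>x \<noteq> 0\<close> show "x \<bullet> (A *v x) > 0"
    by (smt (verit) inner_gt_zero_iff mult_pos_pos)
next
  assume A: "transpose A = A \<and> (\<forall>x. x \<noteq> 0 \<longrightarrow> x \<bullet> (A *v x) > 0)"
  have "c > 0" if c: "eigenvalue_of A c" for c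
  proof -
    obtain x where "x \<noteq> 0" "A *v x = c *\<^sub>R x"
      using c by (auto simp: eigenvalue_of_def)
    with A show ?thesis
      by (metis inner_gt_zero_iff inner_scaleR_right zero_less_mult_pos2)
  qed
  with A show "A \<in> Omega"
    by (simp add: Omega_def symmetric_matrices_def)
qed (simp add: Omega_def symmetric_matrices_def)

lemma openin_Omega: "openin (top_of_set symmetric_matrices) (Omega :: (real ^ 'n ^ 'n) set)"
  unfolding openin_contains_ball
proof (intro conjI ballI)
  fix A :: "real ^ 'n ^ 'n" assume A: "A \<in> Omega"
  then obtain c where c: "c > 0" and le: "\<And>x. c * (x \<bullet> x) \<le> x \<bullet> (A *v x)"
    unfolding Omega_def symmetric_matrices_def
    by (metis (mono_tags, lifting) mem_Collect_eq symmetric_least_eigenvalue)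
  \<comment> \<open>The constant \<open>c\<close> itself serves as radius: passing from A to B
    changes the form at x by at most norm (B - A) times x . x, less than the lower bound for A when
    x is nonzero.\<close>
  have "B \<in> Omega" if B: "B \<in> symmetric_matrices" and near: "norm (B - A) < c" for B
  proof -
    have "x \<bullet> (B *v x) > 0" if "x \<noteq> 0" for x
    proof -
      have "\<bar>x \<bullet> ((B - A) *v x)\<bar> \<le> norm x * norm ((B - A) *v x)"
        by (rule Cauchy_Schwarz_ineq2)
      also have "\<dots> \<le> norm x * (norm (B - A) * norm x)"
        by (intro mult_left_mono norm_matrix_vector_le) simp
      also have "\<dots> < norm x * (c * norm x)"
        using that near by (intro mult_strict_left_mono mult_strict_right_mono) auto
      also have "\<dots> = c * (x \<bullet> x)"
        by (simp add: dot_square_norm power2_eq_square)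
      finally have "\<bar>x \<bullet> ((B - A) *v x)\<bar> < x \<bullet> (A *v x)"
        using le[of x] by linarith
      then show ?thesis
        by (simp add: matrix_vector_mult_diff_rdistrib inner_diff_right)
    qed
    with B show ?thesis
      by (simp add: Omega_iff symmetric_matrices_def)
  qed
  then have "ball A c \<inter> symmetric_matrices \<subseteq> Omega"
    by (auto simp: dist_norm norm_minus_commute)
  with c show "\<exists>e>0. ball A e \<inter> symmetric_matrices \<subseteq> Omega"
    by blast
qed (auto simp: Omega_def)

text \<open>Gram-Schmidt for the inner product with Gram matrix \<open>A\<close>.\<close>

lemma Omega_orthonormal_family:
  fixes A :: "real ^ 'n ^ 'n" and S :: "'n set"
  assumes A: "A \<in> Omega"
  shows "\<exists>b :: 'n \<Rightarrow> real ^ 'n. \<forall>i\<in>S. \<forall>j\<in>S. b i \<bullet> (A *v b j) = (if i = j then 1 else 0)"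
  using finite[of S]
proof (induction S rule: finite_induct)
  case (insert k S)
  then obtain b :: "'n \<Rightarrow> real ^ 'n"
    where b: "\<And>i j. i \<in> S \<Longrightarrow> j \<in> S \<Longrightarrow> b i \<bullet> (A *v b j) = (if i = j then 1 else 0)"
    by blast
  have sym: "transpose A = A" and pos: "\<And>x. x \<noteq> 0 \<Longrightarrow> x \<bullet> (A *v x) > 0"
    using A by (auto simp: Omega_iff)
  \<comment> \<open>Since \<open>k\<close> lies outside \<open>S\<close>, the vectors A b_i are too
    few to span. A nonzero x that is Euclidean-orthogonal to all of them is orthogonal to every b_i
    for the inner product of A, and only has to be normalized.\<close>
  have "dim ((\<lambda>i. A *v b i) ` S) \<le> card S"
    using insert.hyps dim_le_card'[of "(\<lambda>i. A *v b i) ` S"] card_image_le[of S "\<lambda>i. A *v b i"]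
    by simp
  also have "card S < DIM(real ^ 'n)"
    using insert.hyps psubset_card_mono[of UNIV S] by auto
  finally obtain x where x: "x \<noteq> 0"
    and orth: "\<And>y. y \<in> span ((\<lambda>i. A *v b i) ` S) \<Longrightarrow> orthogonal x y"
    using orthogonal_to_subspace_exists by blast
  have xb: "x \<bullet> (A *v b i) = 0" "b i \<bullet> (A *v x) = 0" if "i \<in> S" for i
    using orth[OF span_base[OF imageI[OF that]]] symmetric_inner_commute[OF sym]
    by (metis orthogonal_def)+
  define b' where "b' = b(k := x /\<^sub>R sqrt (x \<bullet> (A *v x)))"
  have "b' i \<bullet> (A *v b' j) = (if i = j then 1 else 0)"
    if "i \<in> insert k S" "j \<in> insert k S" for i j
    using that insert.hyps b xb pos[OF x]
    by (auto simp: b'_def matrix_vector_mult_scaleR field_simps)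
  then show ?case
    by blast
qed simp

section \<open>Gram matrices and their factorizations\<close>

lemma matrix_inv_mult:
  fixes A :: "real ^ 'n ^ 'n"
  assumes "invertible A"
  shows "A ** matrix_inv A = mat 1" "matrix_inv A ** A = mat 1"
    "A *v (matrix_inv A *v x) = x" "matrix_inv A *v (A *v x) = x"
proof -
  have "A ** matrix_inv A = mat 1 \<and> matrix_inv A ** A = mat 1"
    using assms unfolding invertible_def matrix_inv_def by (rule someI_ex)
  then show "A ** matrix_inv A = mat 1" "matrix_inv A ** A = mat 1"
    "A *v (matrix_inv A *v x) = x" "matrix_inv A *v (A *v x) = x"
    by (simp_all add: matrix_vector_mul_assoc)
qed

text \<open>The columns of \<open>P\<close> are an orthonormal basis for the inner product of A, so
  P^t A P = 1. Multiplying by the inverse \<open>L\<close> of \<open>P\<close> on the right and its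
  transpose on the left isolates A.\<close>

lemma Omega_factorization:
  fixes A :: "real ^ 'n ^ 'n"
  assumes A: "A \<in> Omega"
  obtains L :: "real ^ 'n ^ 'n" where "invertible L" "transpose L ** L = A"
proof -
  obtain b :: "'n \<Rightarrow> real ^ 'n"
    where b: "\<And>i j. b i \<bullet> (A *v b j) = (if i = j then 1 else 0)"
    using Omega_orthonormal_family[OF A, of UNIV] by auto
  define P :: "real ^ 'n ^ 'n" where "P = (\<chi> i j. b j $ i)"
  have "(A ** P) $ i $ j = (A *v b j) $ i" for i j
    by (simp add: P_def matrix_matrix_mult_def matrix_vector_mult_def)
  then have "(transpose P ** (A ** P)) $ i $ j = b i \<bullet> (A *v b j)" for i j
    unfolding matrix_matrix_mult_def[of "transpose P"] inner_vec_def
    by (simp add: P_def transpose_def)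
  then have PAP: "transpose P ** (A ** P) = mat 1"
    by (simp add: vec_eq_iff b mat_def)
  then have inv: "invertible P"
    by (metis invertible_left_inverse matrix_mul_assoc)
  define L where "L = matrix_inv P"
  have LP: "L ** P = mat 1" "P ** L = mat 1"
    using inv by (simp_all add: L_def matrix_inv_mult)
  have "transpose L ** transpose P = mat 1"
    by (metis LP(2) matrix_transpose_mul transpose_mat)
  then have "A ** P = transpose L"
    by (metis PAP matrix_mul_assoc matrix_mul_lid matrix_mul_rid)
  then have "transpose L ** L = A"
    by (metis LP(2) matrix_mul_assoc matrix_mul_rid)
  moreover have "invertible L"
    using LP by (auto simp: invertible_def)
  ultimately show ?thesis
    using that by blast
qed

text \<open>The form at x is the squared length of L x, which is nonzero because L is
  injective.\<close>

lemma gram_in_Omega: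
  fixes L :: "real ^ 'n ^ 'n"
  assumes "invertible L"
  shows "transpose L ** L \<in> Omega"
proof -
  have "x \<bullet> ((transpose L ** L) *v x) > 0" if "x \<noteq> 0" for x
  proof -
    have "L *v x \<noteq> 0"
      using that matrix_inv_mult(4)[OF assms, of x] by force
    moreover have "x \<bullet> ((transpose L ** L) *v x) = (L *v x) \<bullet> (L *v x)"
      by (metis dot_lmul_matrix inner_commute matrix_vector_mul_assoc transpose_matrix_vector)
    ultimately show ?thesis
      by simp
  qed
  then show ?thesis
    by (simp add: Omega_iff matrix_transpose_mul transpose_transpose)
qed

text \<open>Source of the linear part of the isometry between two placements with the same \<omega>:
  conjugating the common Gram matrix by the inverse of L yields the identity.\<close>

lemma gram_eq_imp_orthogonal:
  fixes L M :: "real ^ 'n ^ 'n"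
  assumes L: "invertible L" and gram: "transpose L ** L = transpose M ** M"
  shows "orthogonal_matrix (M ** matrix_inv L)"
proof -
  define N where "N = matrix_inv L"
  have "transpose (M ** N) ** (M ** N) = transpose N ** (transpose M ** M) ** N"
    by (simp add: matrix_transpose_mul matrix_mul_assoc)
  also have "\<dots> = transpose (L ** N) ** (L ** N)"
    by (simp add: matrix_transpose_mul matrix_mul_assoc flip: gram)
  also have "\<dots> = mat 1"
    using L by (simp add: N_def matrix_inv_mult transpose_mat)
  finally show ?thesis
    by (simp add: orthogonal_matrix N_def)
qed

subsection \<open>The parameter space as an open subset of a Euclidean space\<close>

text \<open>Counts the free entries of a symmetric matrix. The enumeration \<open>f\<close> orders
  the index type, and column b has f b + 1 entries on or above the diagonal.\<close>

lemma card_linorder_pairs: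
  fixes f :: "'a::finite \<Rightarrow> nat"
  assumes "bij_betw f UNIV {..<CARD('a)}"
  shows "card {(a, b). f a \<le> f b} = CARD('a) + (CARD('a) choose 2)"
proof -
  have inj: "inj f" and ran: "range f = {..<CARD('a)}"
    using assms by (auto simp: bij_betw_def)
  have "card {a. f a \<le> f b} = f b + 1" for b
  proof -
    have "f ` {a. f a \<le> f b} = {..f b}"
    proof (intro equalityI subsetI)
      fix m assume "m \<in> {..f b}"
      moreover have "f b < CARD('a)"
        using ran by auto
      ultimately have "m \<in> range f"
        using ran by simp
      with \<open>m \<in> {..f b}\<close> show "m \<in> f ` {a. f a \<le> f b}"
        by auto
    qed auto
    then show ?thesis
      by (metis card_atMost card_image inj inj_on_subset subset_UNIV Suc_eq_plus1)
  qed
  moreover have "{(a, b). f a \<le> f b} = (SIGMA b:UNIV. {a. f a \<le> f b})\<inverse>"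
    by auto
  ultimately have "card {(a, b). f a \<le> f b} = (\<Sum>b\<in>UNIV. f b + 1)"
    by (simp add: card_inverse)
  also have "\<dots> = (\<Sum>k<CARD('a). k + 1)"
    using sum.reindex_bij_betw[OF assms, of "\<lambda>k. k + 1"] by simp
  also have "\<dots> = CARD('a) + (CARD('a) choose 2)"
    unfolding sum.distrib by (simp add: choose_two lessThan_atLeast0 Sum_Ico_nat)
  finally show ?thesis .
qed

text \<open>Coordinates: all entries of the vectors, and the entries of the symmetric matrix on and above
  the diagonal with respect to an enumeration of the index type.\<close>

lemma linear_identification_exists:
  fixes n :: nat
  assumes n: "n > 0"
  shows "\<exists>\<Phi> :: (nat \<Rightarrow> real ^ 'd) \<times> (real ^ 'd ^ 'd) \<Rightarrow> nat \<Rightarrow> real.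
    linear_identification n (CARD('d::finite) * n + (CARD('d) choose 2)) \<Phi>"
proof -
  define N where "N = CARD('d) * n + (CARD('d) choose 2)"
  obtain f :: "'d \<Rightarrow> nat" where f: "bij_betw f UNIV {..<CARD('d)}"
    using ex_bij_betw_finite_nat[of "UNIV :: 'd set"] by (auto simp: lessThan_atLeast0)
  define J where "J = ({1..<n} \<times> (UNIV :: 'd set)) <+> {(a, b). f a \<le> f b}"
  \<comment> \<open>The diagonal contributes d entries, which make up for the missing vector of
    index 0. As n - 1 is truncated subtraction, n > 0 matters here.\<close>
  have "card J = (n - 1) * CARD('d) + (CARD('d) + (CARD('d) choose 2))"
    unfolding J_def by (subst card_Plus) (auto simp: card_linorder_pairs[OF f])
  also have "\<dots> = N"
    using n by (cases n) (auto simp: N_def)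
  finally obtain h where h: "bij_betw h {..<N} J"
    using ex_bij_betw_nat_finite[of J] by (auto simp: J_def lessThan_atLeast0)
  define k where "k = inv_into {..<N} h"
  have hk: "h (k j) = j" "k j < N" if "j \<in> J" for j
    using that h bij_betw_inv_into_right[OF h that] bij_betwE[OF bij_betw_inv_into[OF h]]
    by (auto simp: k_def)
  have kh: "k (h m) = m" "h m \<in> J" if "m < N" for m
    using that h by (auto simp: k_def bij_betw_inv_into_left bij_betwE)
  define coord :: "(nat \<Rightarrow> real ^ 'd) \<times> (real ^ 'd ^ 'd) \<Rightarrow> (nat \<times> 'd) + ('d \<times> 'd) \<Rightarrow> real"
    where "coord x j = (case j of Inl (i, a) \<Rightarrow> fst x i $ a | Inr (a, b) \<Rightarrow> snd x $ a $ b)" for x j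
  \<comment> \<open>Points of \<open>Euclidean_space N\<close> are sequences that vanish from index
    N on, hence the default 0.\<close>
  define \<Phi> where "\<Phi> x m = (if m < N then coord x (h m) else 0)" for x m
  \<comment> \<open>Reflects a position into the upper triangle. Because \<open>upper\<close> is
    symmetric in its arguments, \<open>\<Psi>\<close> only produces symmetric matrices.\<close>
  define upper where "upper a b = (if f a \<le> f b then (a, b) else (b, a))" for a b
  define \<Psi> :: "(nat \<Rightarrow> real) \<Rightarrow> (nat \<Rightarrow> real ^ 'd) \<times> (real ^ 'd ^ 'd)"
    where "\<Psi> y = (\<lambda>i\<in>{1..<n}. \<chi> a. y (k (Inl (i, a))), \<chi> a b. y (k (Inr (upper a b))))" for y
  have upper: "Inr (upper a b) \<in> J" for a b
    by (auto simp: J_def upper_def)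
  have upper_commute: "upper a b = upper b a" for a b
    using f by (auto simp: upper_def bij_betw_def dest: injD)
  have top: "topspace (ambient_topology n) = ({1..<n} \<rightarrow>\<^sub>E UNIV) \<times> (symmetric_matrices :: (real ^ 'd ^ 'd) set)"
    by (simp add: ambient_topology_def)
  have cont_fst: "continuous_map (ambient_topology n) euclideanreal (\<lambda>x. fst x i $ a)"
    if "i \<in> {1..<n}" for i and a :: 'd
  proof -
    have proj: "continuous_map (ambient_topology n) euclidean (\<lambda>x. fst x i :: real ^ 'd)"
      using continuous_map_compose[OF continuous_map_fst continuous_map_product_projection[OF that]]
      unfolding ambient_topology_def by (simp add: o_def)
    have "continuous_map euclidean euclideanreal (\<lambda>z :: real ^ 'd. z $ a)"
      by (simp add: continuous_on_component)
    from continuous_map_compose[OF proj this] show ?thesis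
      by (simp add: o_def)
  qed
  have cont_snd: "continuous_map (ambient_topology n) euclideanreal (\<lambda>x. snd x $ a $ b)"
    for a b :: 'd
  proof -
    have "continuous_map (top_of_set symmetric_matrices) euclideanreal (\<lambda>z :: real ^ 'd ^ 'd. z $ a $ b)"
      by (simp add: continuous_on_component)
    from continuous_map_compose[OF continuous_map_snd this] show ?thesis
      unfolding ambient_topology_def by (simp add: o_def)
  qed
  have "continuous_map (ambient_topology n) euclideanreal (\<lambda>x. \<Phi> x m)" for m
  proof (cases "m < N")
    case True
    with kh(2)[OF True] show ?thesis
      using cont_fst cont_snd by (cases "h m") (auto simp: \<Phi>_def coord_def J_def)
  qed (simp add: \<Phi>_def)
  then have cont_\<Phi>: "continuous_map (ambient_topology n) (Euclidean_space N) \<Phi>"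
    by (auto simp: Euclidean_space_def continuous_map_in_subtopology continuous_map_componentwise_UNIV \<Phi>_def)
  have cont_\<Psi>: "continuous_map (Euclidean_space N) (ambient_topology n) \<Psi>"
  proof -
    have coord_cont: "continuous_on S (\<lambda>y :: nat \<Rightarrow> real. y m)" for S m
      by (rule continuous_on_subset[OF continuous_on_product_coordinates]) simp
    show ?thesis
      unfolding \<Psi>_def ambient_topology_def
      by (auto simp: continuous_map_paired continuous_map_in_subtopology continuous_map_componentwise
          continuous_map_Euclidean_space_iff symmetric_matrices_def transpose_def vec_eq_iff upper_commute
          intro!: continuous_on_vec_lambda coord_cont)
  qed
  have "\<Psi> (\<Phi> x) = x" if x: "x \<in> topspace (ambient_topology n)" for x
  proof (rule prod_eqI)
    have "(\<chi> a. \<Phi> x (k (Inl (i, a)))) = fst x i" if "i \<in> {1..<n}" for i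
    proof -
      have "Inl (i, a) \<in> J" for a
        using that by (auto simp: J_def)
      with hk show ?thesis
        by (simp add: \<Phi>_def coord_def vec_eq_iff)
    qed
    with x show "fst (\<Psi> (\<Phi> x)) = fst x"
      by (auto simp: \<Psi>_def top PiE_def extensional_def)
    have "snd x $ a $ b = snd x $ b $ a" for a b
      using x by (auto simp: top symmetric_matrices_def transpose_def vec_eq_iff)
    then show "snd (\<Psi> (\<Phi> x)) = snd x"
      using hk upper by (auto simp: \<Psi>_def \<Phi>_def coord_def vec_eq_iff upper_def)
  qed
  moreover have "\<Phi> (\<Psi> y) = y" if y: "y \<in> topspace (Euclidean_space N)" for y
  proof
    fix m
    show "\<Phi> (\<Psi> y) m = y m"
    proof (cases "m < N")
      case True
      with kh[OF True] show ?thesis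
        by (cases "h m") (auto simp: \<Phi>_def \<Psi>_def coord_def J_def upper_def)
    next
      case False
      with y show ?thesis
        by (simp add: \<Phi>_def topspace_Euclidean_space)
    qed
  qed
  ultimately have "homeomorphic_map (ambient_topology n) (Euclidean_space N) \<Phi>"
    unfolding homeomorphic_map_maps homeomorphic_maps_def using cont_\<Phi> cont_\<Psi> by blast
  moreover have "\<Phi> (ambient_lincomb n a x b y) = (\<lambda>m. a * \<Phi> x m + b * \<Phi> y m)" for a b x y
  proof
    fix m
    show "\<Phi> (ambient_lincomb n a x b y) m = a * \<Phi> x m + b * \<Phi> y m"
      using kh(2)[of m]
      by (cases "h m") (auto simp: \<Phi>_def coord_def ambient_lincomb_def J_def)
  qed
  ultimately show ?thesis
    unfolding linear_identification_def N_def by blast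
qed

lemma openin_parameter_space:
  "openin (ambient_topology n) (parameter_space n :: ((nat \<Rightarrow> real ^ 'd::finite) \<times> _) set)"
proof -
  have "openin (product_topology (\<lambda>_. euclidean) {1..<n}) ({1..<n} \<rightarrow>\<^sub>E (UNIV :: (real ^ 'd) set))"
    using openin_topspace[of "product_topology (\<lambda>_. euclidean) {1..<n}"] by simp
  then show ?thesis
    unfolding ambient_topology_def parameter_space_def
    by (simp add: openin_prod_Times_iff openin_Omega)
qed

lemma parameter_space_identification:
  assumes "n > 0"
  shows "\<exists>\<Phi> :: (nat \<Rightarrow> real ^ 'd) \<times> (real ^ 'd ^ 'd) \<Rightarrow> nat \<Rightarrow> real.
    linear_identification n (CARD('d::finite) * n + (CARD('d) choose 2)) \<Phi> \<and>
    openin (Euclidean_space (CARD('d) * n + (CARD('d) choose 2))) (\<Phi> ` parameter_space n)"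
  using linear_identification_exists[OF assms, where 'd = 'd] openin_parameter_space[of n]
  unfolding linear_identification_def
  by (meson homeomorphic_map_openness_eq)

subsection \<open>Lattices and placements\<close>

text \<open>The inclusion of Z^d, encoded as finitely supported integer functions, into R^d. Through
  it a homomorphism on \<Gamma> becomes multiplication by its lattice matrix.\<close>

definition int_vec :: "('d::finite \<Rightarrow>\<^sub>0 int) \<Rightarrow> real ^ 'd" where
  "int_vec c = (\<chi> j. of_int (Poly_Mapping.lookup c j))"

lemma int_vec_simps [simp]:
  "int_vec 0 = 0" "int_vec (a + b) = int_vec a + int_vec b" "int_vec (a - b) = int_vec a - int_vec b"
  "int_vec (frag_of j) = axis j 1"
  by (simp_all add: int_vec_def vec_eq_iff lookup_add lookup_minus axis_def)

lemma int_vec_inj: "int_vec a = int_vec b \<longleftrightarrow> a = b"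
  by (auto simp: int_vec_def vec_eq_iff intro: poly_mapping_eqI)

text \<open>The columns of L are a lattice basis: they span the space and there are exactly d of
  them, so they are independent.\<close>

lemma lattice_image_int_vec:
  fixes L :: "real ^ 'd ^ 'd::finite"
  assumes L: "invertible L"
  shows "lattice_of_rank CARD('d) (range (\<lambda>c. L *v int_vec c))"
proof -
  define B where "B = range (\<lambda>j. column j L)"
  have B: "B = columns L"
    by (auto simp: B_def columns_def)
  have inj: "inj (\<lambda>j. column j L)"
  proof (rule injI)
    fix i j assume "column i L = column j L"
    then have "L *v axis i 1 = L *v axis j 1"
      by (simp add: matrix_vector_mult_basis)
    then have "axis i (1 :: real) = axis j 1"
      by (metis L matrix_inv_mult(4))
    then show "i = j"
      by (simp add: axis_eq_axis)
  qed
  have span: "span B = UNIV"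
    using L matrix_right_invertible_span_columns[of L] by (auto simp: B invertible_def span_vec_eq)
  have card: "card B = CARD('d)"
    by (simp add: B_def card_image inj)
  have "independent B"
    using card_le_dim_spanning[of B UNIV] span card by (auto simp: B_def)
  moreover have "range (\<lambda>c. L *v int_vec c) = {\<Sum>b\<in>B. of_int (c b) *\<^sub>R b | c :: real ^ 'd \<Rightarrow> int. True}"
    (is "?R = ?L")
  proof (intro equalityI subsetI)
    fix x assume "x \<in> ?R"
    then obtain c where c: "x = L *v int_vec c"
      by blast
    \<comment> \<open>Lattice coefficients are indexed by basis vectors, those of \<open>c\<close>
      by coordinates; distinctness of the columns allows the translation.\<close>
    define k where "k b = Poly_Mapping.lookup c (inv_into UNIV (\<lambda>j. column j L) b)" for b
    have "x = (\<Sum>j\<in>UNIV. of_int (Poly_Mapping.lookup c j) *\<^sub>R column j L)"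
      by (simp add: c matrix_mult_sum int_vec_def scalar_mult_eq_scaleR)
    also have "\<dots> = (\<Sum>b\<in>B. of_int (k b) *\<^sub>R b)"
      unfolding B_def by (subst sum.reindex[OF inj]) (simp add: k_def inv_f_f[OF inj])
    finally show "x \<in> ?L"
      by blast
  next
    fix x assume "x \<in> ?L"
    then obtain k :: "real ^ 'd \<Rightarrow> int" where k: "x = (\<Sum>b\<in>B. of_int (k b) *\<^sub>R b)"
      by blast
    define c where "c = Abs_poly_mapping (\<lambda>j. k (column j L))"
    have "L *v int_vec c = (\<Sum>j\<in>UNIV. of_int (k (column j L)) *\<^sub>R column j L)"
      by (simp add: matrix_mult_sum int_vec_def scalar_mult_eq_scaleR c_def)
    also have "\<dots> = x"
      unfolding k B_def by (subst sum.reindex[OF inj]) simp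
    finally show "x \<in> ?R"
      by blast
  qed
  ultimately show ?thesis
    using card unfolding lattice_of_rank_def by (intro exI[of _ B]) (auto simp: B_def)
qed

text \<open>The range of L contains the d independent generators of the lattice, hence everything
  they span; a surjective square matrix is invertible.\<close>

lemma invertible_of_full_lattice:
  fixes L :: "real ^ 'd ^ 'd::finite"
  assumes "lattice_of_rank CARD('d) (range (\<lambda>c. L *v int_vec c))"
  shows "invertible L"
proof -
  obtain B where B: "finite B" "independent B" "card B = CARD('d)"
    and lat: "range (\<lambda>c. L *v int_vec c) = {\<Sum>b\<in>B. of_int (k b) *\<^sub>R b | k :: real ^ 'd \<Rightarrow> int. True}"
    using assms unfolding lattice_of_rank_def by blast
  have "b \<in> range ((*v) L)" if "b \<in> B" for b
  proof -
    have "b = (\<Sum>b'\<in>B. of_int (if b' = b then 1 else 0) *\<^sub>R b')"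
      using that B(1) by (simp add: if_distrib[of of_int] if_distrib[of "\<lambda>r. r *\<^sub>R _"] sum.delta cong: if_cong)
    then have "b \<in> range (\<lambda>c. L *v int_vec c)"
      unfolding lat by (intro CollectI exI[of _ "\<lambda>b'. if b' = b then 1 else 0"]) simp
    then show ?thesis
      by blast
  qed
  then have "span B \<subseteq> range ((*v) L)"
    by (intro span_minimal linear_subspace_image) auto
  moreover have "UNIV \<subseteq> span B"
    using B by (intro card_ge_dim_independent) auto
  ultimately have "surj ((*v) L)"
    by blast
  then show ?thesis
    using matrix_right_invertible_surjective[of L] invertible_right_inverse by blast
qed

lemma placement_equivE:
  assumes "(P, Q) \<in> placement_equiv V \<Gamma>"
  obtains U t where "orthogonal_matrix U" "Q = isometry_action V \<Gamma> U t P"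
    "P \<in> periodic_placements V \<Gamma>" "Q \<in> periodic_placements V \<Gamma>"
proof -
  from assms have "P \<in> periodic_placements V \<Gamma> \<and> Q \<in> periodic_placements V \<Gamma> \<and>
      (\<exists>U t. orthogonal_matrix U \<and> Q = isometry_action V \<Gamma> U t P)"
    by (simp add: placement_equiv_def)
  then show ?thesis
    by (elim exE conjE) (rule that)
qed

lemma placement_equivI:
  assumes "P \<in> periodic_placements V \<Gamma>" "Q \<in> periodic_placements V \<Gamma>"
    "orthogonal_matrix U" "Q = isometry_action V \<Gamma> U t P"
  shows "(P, Q) \<in> placement_equiv V \<Gamma>"
  unfolding placement_equiv_def mem_Collect_eq prod.case
  by (intro conjI exI[of _ U] exI[of _ t] assms)

lemma isometry_action_simps [simp]:
  "isometry_action V \<Gamma> U t (p, \<pi>) = (\<lambda>x\<in>V. U *v p x + t, \<lambda>\<gamma>\<in>\<Gamma>. U *v \<pi> \<gamma>)"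
  by (simp add: isometry_action_def)

lemma placement_parameters_pair [simp]:
  "placement_parameters \<phi> n v (p, \<pi>) =
    (\<lambda>i\<in>{1..<n}. matrix_inv (lattice_matrix \<phi> \<pi>) *v (p (v i) - p (v 0)),
     transpose (lattice_matrix \<phi> \<pi>) ** lattice_matrix \<phi> \<pi>)"
  by (simp add: placement_parameters_def Let_def)

section \<open>Coordinates on the group and on the vertices\<close>

locale marked_graph =
  fixes V :: "'v set" and \<Gamma> :: "('v \<Rightarrow> 'v) set" and n :: nat and v :: "nat \<Rightarrow> 'v"
    and \<phi> :: "('d::finite \<Rightarrow>\<^sub>0 int) \<Rightarrow> 'v \<Rightarrow> 'v"
  assumes subgroup: "subgroup \<Gamma> (BijGroup V)"
    and free: "\<And>\<gamma> x. \<gamma> \<in> \<Gamma> \<Longrightarrow> x \<in> V \<Longrightarrow> \<gamma> x = x \<Longrightarrow> \<gamma> = \<one>\<^bsub>BijGroup V\<^esub>"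
    and representatives: "orbit_representatives V \<Gamma> n v"
    and iso: "\<phi> \<in> iso (free_Abelian_group (UNIV :: 'd set)) (perm_group V \<Gamma>)"
    and n_pos: "n > 0"
begin

lemma \<Gamma>_Bij: "\<Gamma> \<subseteq> Bij V"
  using subgroup.subset[OF subgroup] by (simp add: BijGroup_def)

lemma \<phi>_in [simp]: "\<phi> c \<in> \<Gamma>"
  using iso by (auto simp: iso_def hom_def free_Abelian_group_def)

lemma \<phi>_V [simp]: "x \<in> V \<Longrightarrow> \<phi> c x \<in> V"
  using Bij_imp_funcset[of "\<phi> c" V] \<Gamma>_Bij \<phi>_in by blast

lemma \<phi>_inj: "\<phi> a = \<phi> b \<longleftrightarrow> a = b"
  using iso by (auto simp: iso_def free_Abelian_group_def bij_betw_def inj_on_def)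

lemma \<Gamma>_eq: "\<Gamma> = range \<phi>"
  using iso by (auto simp: iso_def free_Abelian_group_def bij_betw_def)

lemma \<phi>_mult: "\<phi> (a + b) = \<phi> a \<otimes>\<^bsub>perm_group V \<Gamma>\<^esub> \<phi> b"
  using iso by (simp add: iso_def hom_def free_Abelian_group_def)

lemma \<phi>_add: "x \<in> V \<Longrightarrow> \<phi> (a + b) x = \<phi> a (\<phi> b x)"
proof -
  have "\<phi> a \<in> Bij V" "\<phi> b \<in> Bij V"
    using \<Gamma>_Bij \<phi>_in by blast+
  then show "\<phi> (a + b) x = \<phi> a (\<phi> b x)" if "x \<in> V"
    using that by (simp add: \<phi>_mult BijGroup_def compose_eq)
qed

text \<open>The preimage \<open>c\<close> of the identity satisfies \<phi> (c + c) = \<phi> c, and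
  injectivity gives c = 0.\<close>

lemma \<phi>_zero: "\<phi> 0 = \<one>\<^bsub>BijGroup V\<^esub>"
proof -
  have "\<one>\<^bsub>BijGroup V\<^esub> \<in> \<Gamma>"
    by (rule subgroup.one_closed[OF subgroup])
  then obtain c where c: "\<phi> c = \<one>\<^bsub>BijGroup V\<^esub>"
    unfolding \<Gamma>_eq by (metis imageE)
  have "\<phi> (c + c) = \<phi> c"
    using group.is_monoid[OF group_BijGroup, of V]
    by (simp add: \<phi>_mult c monoid.l_one monoid.one_closed)
  then have "c = 0"
    by (simp add: \<phi>_inj)
  with c show ?thesis
    by simp
qed

lemma \<phi>_zero_apply [simp]: "x \<in> V \<Longrightarrow> \<phi> 0 x = x"
  by (simp add: \<phi>_zero BijGroup_def)

lemma \<phi>_free: "x \<in> V \<Longrightarrow> \<phi> a x = \<phi> b x \<longleftrightarrow> a = b"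
proof
  assume x: "x \<in> V" and eq: "\<phi> a x = \<phi> b x"
  have "\<phi> (a - b) (\<phi> b x) = \<phi> b x"
    using x eq \<phi>_add[of x "a - b" b] by simp
  then have "\<phi> (a - b) = \<phi> 0"
    unfolding \<phi>_zero using x by (intro free[of _ "\<phi> b x"]) auto
  then show "a = b"
    by (simp add: \<phi>_inj)
qed simp

lemma orbit_eq: "orbit (perm_group V \<Gamma>) (\<lambda>\<gamma>. \<gamma>) x = range (\<lambda>c. \<phi> c x)"
  by (auto simp: orbit_def \<Gamma>_eq)

lemma v_in [simp]: "i < n \<Longrightarrow> v i \<in> V"
  using representatives by (auto simp: orbit_representatives_def)

text \<open>With \<open>vertex_cases\<close> this gives each vertex unique coordinates (i, c). A
  common point makes two orbits equal, which fixes the index; freeness then fixes the group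
  element.\<close>

lemma vertex_unique:
  assumes "i < n" "j < n"
  shows "\<phi> a (v i) = \<phi> b (v j) \<longleftrightarrow> i = j \<and> a = b"
proof
  assume eq: "\<phi> a (v i) = \<phi> b (v j)"
  have "\<phi> c (v i) = \<phi> (c - a + b) (v j)" "\<phi> c (v j) = \<phi> (c - b + a) (v i)" for c
    using assms \<phi>_add[of "v i" "c - a" a] \<phi>_add[of "v j" "c - a" b]
      \<phi>_add[of "v i" "c - b" a] \<phi>_add[of "v j" "c - b" b] eq by simp_all
  then have "range (\<lambda>c. \<phi> c (v i)) = range (\<lambda>c. \<phi> c (v j))"
    by (intro equalityI image_subsetI) (metis rangeI)+
  then have "i = j"
    using representatives assms
    by (auto simp: orbit_representatives_def bij_betw_def orbit_eq inj_on_def)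
  with eq assms show "i = j \<and> a = b"
    by (simp add: \<phi>_free)
qed simp

lemma vertex_cases:
  assumes "x \<in> V"
  obtains i c where "i < n" "x = \<phi> c (v i)"
proof -
  have "orbit (perm_group V \<Gamma>) (\<lambda>\<gamma>. \<gamma>) x \<in> vertex_orbits V \<Gamma>"
    using assms by (auto simp: vertex_orbits_def orbits_def)
  then have "range (\<lambda>c. \<phi> c x) \<in> (\<lambda>i. range (\<lambda>c. \<phi> c (v i))) ` {..<n}"
    using representatives by (simp add: orbit_representatives_def bij_betw_def orbit_eq)
  then obtain i where i: "i < n" "range (\<lambda>c. \<phi> c x) = range (\<lambda>c. \<phi> c (v i))"
    by blast
  have "x = \<phi> 0 x"
    using assms by simp
  then have "x \<in> range (\<lambda>c. \<phi> c (v i))"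
    unfolding i(2)[symmetric] by blast
  with i that show ?thesis
    by blast
qed

text \<open>The columns of the lattice matrix are the values of \<pi> on the basis. Generators and
  differences exhaust the free abelian group, so additivity extends the formula.\<close>

lemma placement_linear:
  assumes \<pi>: "\<pi> \<in> hom (perm_group V \<Gamma>) translation_group"
  shows "\<pi> (\<phi> c) = lattice_matrix \<phi> \<pi> *v int_vec c"
proof -
  have add: "\<pi> (\<phi> (a + b)) = \<pi> (\<phi> a) + \<pi> (\<phi> b)" for a b
    using \<pi> by (simp add: \<phi>_mult hom_def translation_group_def)
  have zero: "\<pi> (\<phi> 0) = 0"
    using add[of 0 0] by simp
  have "Poly_Mapping.keys c \<subseteq> UNIV"
    by simp
  then show ?thesis
  proof (induction c rule: frag_induction)
    case (one j)
    then show ?case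
      by (simp add: matrix_vector_mult_basis column_def lattice_matrix_def vec_eq_iff)
  next
    case (diff a b)
    then show ?case
      using add[of "a - b" b] by (simp add: matrix_vector_mult_diff_distrib eq_diff_eq)
  qed (simp add: zero)
qed

text \<open>The working description of placements: one invertible matrix encodes the homomorphism
  property, injectivity and the rank of the lattice together.\<close>

lemma periodic_placements_iff:
  fixes p :: "'v \<Rightarrow> real ^ 'd"
  shows "(p, \<pi>) \<in> periodic_placements V \<Gamma> \<longleftrightarrow>
    p \<in> extensional V \<and> \<pi> \<in> extensional \<Gamma> \<and>
    (\<exists>L. invertible L \<and> (\<forall>c. \<pi> (\<phi> c) = L *v int_vec c) \<and>
      (\<forall>c. \<forall>x\<in>V. p (\<phi> c x) = p x + L *v int_vec c))" (is "?lhs \<longleftrightarrow> ?rhs")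
proof
  assume l: ?lhs
  then have \<pi>: "\<pi> (\<phi> c) = lattice_matrix \<phi> \<pi> *v int_vec c" for c
    by (intro placement_linear) (auto simp: periodic_placements_def mon_def)
  have "\<pi> ` \<Gamma> = range (\<lambda>c. lattice_matrix \<phi> \<pi> *v int_vec c)"
    unfolding \<Gamma>_eq image_image by (simp add: \<pi>)
  with l have "invertible (lattice_matrix \<phi> \<pi>)"
    by (intro invertible_of_full_lattice) (simp add: periodic_placements_def)
  with l \<pi> show ?rhs
    by (auto simp: periodic_placements_def intro!: exI[of _ "lattice_matrix \<phi> \<pi>"])
next
  assume ?rhs
  then obtain L where ext: "p \<in> extensional V" "\<pi> \<in> extensional \<Gamma>" and L: "invertible L"
    and \<pi>: "\<And>c. \<pi> (\<phi> c) = L *v int_vec c"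
    and p: "\<And>c x. x \<in> V \<Longrightarrow> p (\<phi> c x) = p x + L *v int_vec c"
    by blast
  have "\<pi> ` \<Gamma> = range (\<lambda>c. L *v int_vec c)"
    unfolding \<Gamma>_eq image_image by (simp add: \<pi>)
  then have "lattice_of_rank CARD('d) (\<pi> ` \<Gamma>)"
    using lattice_image_int_vec[OF L] by simp
  moreover have "L *v int_vec a = L *v int_vec b \<longleftrightarrow> a = b" for a b
    by (metis L int_vec_inj matrix_inv_mult(4))
  then have "inj_on \<pi> \<Gamma>"
    by (auto simp: inj_on_def \<Gamma>_eq \<pi>)
  moreover have "\<pi> (\<phi> a \<otimes>\<^bsub>perm_group V \<Gamma>\<^esub> \<phi> b) = \<pi> (\<phi> a) + \<pi> (\<phi> b)" for a b
    unfolding \<phi>_mult[symmetric] by (simp add: \<pi> matrix_vector_right_distrib)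
  then have "\<pi> \<in> hom (perm_group V \<Gamma>) translation_group"
    by (auto simp: hom_def translation_group_def \<Gamma>_eq)
  ultimately show ?lhs
    using ext p by (auto simp: periodic_placements_def mon_def \<Gamma>_eq \<pi>)
qed

text \<open>Evaluation at the basis vectors reads off the columns, so the matrix in
  \<open>periodic_placements_iff\<close> is unique.\<close>

lemma lattice_matrix_eqI:
  assumes "\<And>c. \<pi> (\<phi> c) = L *v int_vec c"
  shows "lattice_matrix \<phi> \<pi> = L"
  by (simp add: matrix_vector_mult_basis lattice_matrix_def assms vec_eq_iff column_def)

lemma placementD:
  fixes p :: "'v \<Rightarrow> real ^ 'd"
  assumes "(p, \<pi>) \<in> periodic_placements V \<Gamma>"
  shows "p \<in> extensional V" "\<pi> \<in> extensional \<Gamma>" "invertible (lattice_matrix \<phi> \<pi>)"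
    "\<pi> (\<phi> c) = lattice_matrix \<phi> \<pi> *v int_vec c"
    "x \<in> V \<Longrightarrow> p (\<phi> c x) = p x + lattice_matrix \<phi> \<pi> *v int_vec c"
  using assms lattice_matrix_eqI[of \<pi>] unfolding periodic_placements_iff by metis+

lemma lattice_matrix_isometry:
  fixes p :: "'v \<Rightarrow> real ^ 'd"
  assumes "(p, \<pi>) \<in> periodic_placements V \<Gamma>"
  shows "lattice_matrix \<phi> (\<lambda>\<gamma>\<in>\<Gamma>. U *v \<pi> \<gamma>) = U ** lattice_matrix \<phi> \<pi>"
  by (rule lattice_matrix_eqI) (simp add: placementD(4)[OF assms] matrix_vector_mul_assoc)

section \<open>Equivalence of placements under isometries\<close>

lemma placement_equiv_refl: "refl_on (periodic_placements V \<Gamma> :: ('v, 'd) placement set) (placement_equiv V \<Gamma>)"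
proof (rule refl_onI)
  fix P :: "('v, 'd) placement" assume P: "P \<in> periodic_placements V \<Gamma>"
  obtain p \<pi> where [simp]: "P = (p, \<pi>)"
    by (rule prod.exhaust)
  have "P = isometry_action V \<Gamma> (mat 1) 0 P"
    using placementD(1,2)[of p \<pi>] P by (simp add: extensional_restrict)
  then show "(P, P) \<in> placement_equiv V \<Gamma>"
    by (rule placement_equivI[OF P P orthogonal_matrix_id])
qed

lemma placement_equiv_sym: "sym (placement_equiv V \<Gamma> :: (('v, 'd) placement \<times> _) set)"
proof (rule symI)
  fix P Q :: "('v, 'd) placement" assume "(P, Q) \<in> placement_equiv V \<Gamma>"
  then obtain U t where U: "orthogonal_matrix U" and Q: "Q = isometry_action V \<Gamma> U t P"
    and PP: "P \<in> periodic_placements V \<Gamma>" and QP: "Q \<in> periodic_placements V \<Gamma>"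
    by (rule placement_equivE)
  obtain p \<pi> where P: "P = (p, \<pi>)"
    by (rule prod.exhaust)
  note ext = placementD(1,2)[OF PP[unfolded P]]
  define W where "W = transpose U"
  have inv: "W *v (U *v x) = x" for x
    using U by (simp add: W_def orthogonal_matrix matrix_vector_mul_assoc)
  \<comment> \<open>The inverse of x -> U x + t is x -> W x - W t; extensionality of p and \<pi>
    turns agreement on V and \<Gamma> into equality.\<close>
  have "p = (\<lambda>x\<in>V. W *v (\<lambda>x\<in>V. U *v p x + t) x + - (W *v t))"
    using ext(1) by (intro extensionalityI[of p V]) (simp_all add: matrix_vector_right_distrib inv)
  moreover have "\<pi> = (\<lambda>\<gamma>\<in>\<Gamma>. W *v (\<lambda>\<gamma>\<in>\<Gamma>. U *v \<pi> \<gamma>) \<gamma>)"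
    using ext(2) by (intro extensionalityI[of \<pi> \<Gamma>]) (simp_all add: inv)
  ultimately have "P = isometry_action V \<Gamma> (W) (- (W *v t)) Q"
    unfolding P Q isometry_action_simps by (rule arg_cong2)
  moreover have "orthogonal_matrix (W)"
    using U by (simp add: W_def orthogonal_matrix_transpose)
  ultimately show "(Q, P) \<in> placement_equiv V \<Gamma>"
    by (intro placement_equivI[OF QP PP])
qed

lemma placement_equiv_trans: "trans (placement_equiv V \<Gamma> :: (('v, 'd) placement \<times> _) set)"
proof (rule transI)
  fix P Q R :: "('v, 'd) placement"
  assume PQ: "(P, Q) \<in> placement_equiv V \<Gamma>" and QR: "(Q, R) \<in> placement_equiv V \<Gamma>"
  obtain U t where U: "orthogonal_matrix U" and Q: "Q = isometry_action V \<Gamma> U t P"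
    and P: "P \<in> periodic_placements V \<Gamma>"
    using PQ by (rule placement_equivE)
  obtain U' t' where U': "orthogonal_matrix U'" and R: "R = isometry_action V \<Gamma> U' t' Q"
    and RP: "R \<in> periodic_placements V \<Gamma>"
    using QR by (rule placement_equivE)
  have "R = isometry_action V \<Gamma> (U' ** U) (U' *v t + t') P"
    unfolding Q R by (cases P)
      (auto simp: matrix_vector_right_distrib matrix_vector_mul_assoc intro!: restrict_ext)
  then show "(P, R) \<in> placement_equiv V \<Gamma>"
    by (rule placement_equivI[OF P RP orthogonal_matrix_mul[OF U' U]])
qed

lemma equiv_placement_equiv:
  "equiv (periodic_placements V \<Gamma> :: ('v, 'd) placement set) (placement_equiv V \<Gamma>)"
  by (intro equivI placement_equiv_refl placement_equiv_sym placement_equiv_trans)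
    (auto simp: placement_equiv_def)

section \<open>The parameters as a complete set of invariants\<close>

lemma placement_parameters_eqI:
  fixes P :: "('v, 'd) placement"
  assumes "(P, Q) \<in> placement_equiv V \<Gamma>"
  shows "placement_parameters \<phi> n v P = placement_parameters \<phi> n v Q"
proof -
  obtain p \<pi> where P: "P = (p, \<pi>)"
    by (rule prod.exhaust)
  obtain U t where U: "orthogonal_matrix U" and Q: "Q = isometry_action V \<Gamma> U t P"
    and PP: "(p, \<pi>) \<in> periodic_placements V \<Gamma>"
    using assms unfolding P by (rule placement_equivE)
  define L where "L = lattice_matrix \<phi> \<pi>"
  have L: "invertible L"
    using placementD(3)[OF PP] by (simp add: L_def)
  \<comment> \<open>This is the cancellation (U L)^-1 U = L^-1, obtained by writing x as L applied
    to L^-1 x.\<close>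
  have inv: "matrix_inv (U ** L) *v (U *v x) = matrix_inv L *v x" for x
  proof -
    have "invertible U"
      using U by (auto simp: orthogonal_matrix_def invertible_def)
    then have "invertible (U ** L)"
      using L by (rule invertible_mult)
    from matrix_inv_mult(4)[OF this, of "matrix_inv L *v x"] show ?thesis
      using matrix_inv_mult(3)[OF L, of x] by (simp flip: matrix_vector_mul_assoc)
  qed
  have "transpose (U ** L) ** (U ** L) = transpose L ** (transpose U ** U) ** L"
    by (simp add: matrix_transpose_mul matrix_mul_assoc)
  then have gram: "transpose (U ** L) ** (U ** L) = transpose L ** L"
    using U by (simp add: orthogonal_matrix)
  have "matrix_inv (U ** L) *v ((U *v p (v i) + t) - (U *v p (v 0) + t))
      = matrix_inv L *v (p (v i) - p (v 0))" for i
    using inv[of "p (v i) - p (v 0)"] by (simp add: matrix_vector_mult_diff_distrib)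
  then show ?thesis
    unfolding P Q isometry_action_simps placement_parameters_pair lattice_matrix_isometry[OF PP]
    using n_pos gram by (auto simp: L_def[symmetric] intro!: restrict_ext)
qed

text \<open>Equal Gram matrices make U = M L^-1 orthogonal, and \<open>t\<close> is chosen to match
  the images of v 0. Equal t_i then match the other representatives, and periodicity spreads the
  agreement over the orbits.\<close>

lemma placement_equiv_of_parameters_eq:
  fixes P Q :: "('v, 'd) placement"
  assumes P: "P \<in> periodic_placements V \<Gamma>" and Q: "Q \<in> periodic_placements V \<Gamma>"
    and eq: "placement_parameters \<phi> n v P = placement_parameters \<phi> n v Q"
  shows "(P, Q) \<in> placement_equiv V \<Gamma>"
proof -
  obtain p \<pi> q \<rho> where PQ: "P = (p, \<pi>)" "Q = (q, \<rho>)"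
    by (metis surj_pair)
  note p = placementD[OF P[unfolded PQ]] and q = placementD[OF Q[unfolded PQ]]
  define L where "L = lattice_matrix \<phi> \<pi>"
  define M where "M = lattice_matrix \<phi> \<rho>"
  note p = p[folded L_def] and q = q[folded M_def]
  have gram: "transpose L ** L = transpose M ** M"
    and "(\<lambda>i\<in>{1..<n}. matrix_inv L *v (p (v i) - p (v 0))) = (\<lambda>i\<in>{1..<n}. matrix_inv M *v (q (v i) - q (v 0)))"
    using eq by (simp_all add: PQ L_def M_def)
  \<comment> \<open>The parameters only list indices from 1 on; at the base index 0 both sides are
    0.\<close>
  then have "matrix_inv L *v (p (v i) - p (v 0)) = matrix_inv M *v (q (v i) - q (v 0))"
    if "i < n" for i
    using that by (cases "i = 0") (auto simp: fun_eq_iff restrict_def dest: spec[of _ i])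
  then have rel: "M *v (matrix_inv L *v (p (v i) - p (v 0))) = q (v i) - q (v 0)" if "i < n" for i
    using that q(3) by (simp add: matrix_inv_mult)
  define U where "U = M ** matrix_inv L"
  have U: "orthogonal_matrix U"
    unfolding U_def by (rule gram_eq_imp_orthogonal[OF p(3) gram])
  have UL: "U *v (L *v x) = M *v x" for x
    using p(3) by (simp add: U_def matrix_inv_mult flip: matrix_vector_mul_assoc)
  define t where "t = q (v 0) - U *v p (v 0)"
  have "q x = U *v p x + t" if x: "x \<in> V" for x
  proof -
    obtain i c where i: "i < n" and x: "x = \<phi> c (v i)"
      using vertex_cases[OF x] by blast
    have "U *v p (v i) - U *v p (v 0) = q (v i) - q (v 0)"
      using rel[OF i] by (simp add: U_def flip: matrix_vector_mul_assoc matrix_vector_mult_diff_distrib)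
    then show ?thesis
      using i by (simp add: x p(5) q(5) matrix_vector_right_distrib UL t_def algebra_simps)
  qed
  then have "q = (\<lambda>x\<in>V. U *v p x + t)"
    using q(1) by (intro extensionalityI[of q V]) simp_all
  moreover have "\<rho> = (\<lambda>\<gamma>\<in>\<Gamma>. U *v \<pi> \<gamma>)"
    using q(2) by (intro extensionalityI[of \<rho> \<Gamma>]) (auto simp: \<Gamma>_eq p(4) q(4) UL)
  ultimately have "Q = isometry_action V \<Gamma> U t P"
    by (simp add: PQ)
  with P Q U show ?thesis
    by (rule placement_equivI)
qed

lemma placement_parameters_in:
  fixes P :: "('v, 'd) placement"
  assumes "P \<in> periodic_placements V \<Gamma>"
  shows "placement_parameters \<phi> n v P \<in> parameter_space n"
proof -
  obtain p \<pi> where P: "P = (p, \<pi>)"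
    by (rule prod.exhaust)
  have "invertible (lattice_matrix \<phi> \<pi>)"
    using placementD(3) assms unfolding P by blast
  then show ?thesis
    by (simp add: P parameter_space_def gram_in_Omega)
qed

text \<open>The witness puts v 0 at the origin and sends the vertex with coordinates (i, c) to L
  (s_i + c), where L factors the prescribed Gram matrix.\<close>

lemma placement_parameters_surj:
  assumes y: "y \<in> parameter_space n"
  obtains P :: "('v, 'd) placement"
  where "P \<in> periodic_placements V \<Gamma>" "placement_parameters \<phi> n v P = y"
proof -
  obtain t A where yt: "y = (t, A)" and t: "t \<in> {1..<n} \<rightarrow>\<^sub>E UNIV" and A: "A \<in> Omega"
    using y by (auto simp: parameter_space_def)
  obtain L :: "real ^ 'd ^ 'd" where L: "invertible L" and LA: "transpose L ** L = A"
    using Omega_factorization[OF A] by blast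
  define s where "s i = (if i = 0 then 0 else t i)" for i
  define \<pi> where "\<pi> = (\<lambda>\<gamma>\<in>\<Gamma>. L *v int_vec (inv_into UNIV \<phi> \<gamma>))"
  \<comment> \<open>Reads off the coordinates of a vertex; \<open>vertex_unique\<close> makes the
    description definite.\<close>
  define loc where "loc x = (THE ic. fst ic < n \<and> x = \<phi> (snd ic) (v (fst ic)))" for x
  define p where "p = (\<lambda>x\<in>V. L *v (s (fst (loc x)) + int_vec (snd (loc x))))"
  have \<pi>: "\<pi> (\<phi> c) = L *v int_vec c" for c
    by (simp add: \<pi>_def inv_f_f inj_def \<phi>_inj)
  have "loc (\<phi> c (v i)) = (i, c)" if "i < n" for i c
    unfolding loc_def using that by (intro the_equality) (auto simp: vertex_unique)
  then have p: "p (\<phi> c (v i)) = L *v (s i + int_vec c)" if "i < n" for i c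
    using that by (simp add: p_def)
  then have pv: "p (v i) = L *v s i" if "i < n" for i
    using that p[OF that, of 0] by simp
  have "p (\<phi> c x) = p x + L *v int_vec c" if x: "x \<in> V" for c x
  proof -
    obtain i a where "i < n" "x = \<phi> a (v i)"
      using vertex_cases[OF x] by blast
    then show ?thesis
      using p[of i "c + a"] p[of i a] by (simp add: \<phi>_add matrix_vector_right_distrib)
  qed
  then have "(p, \<pi>) \<in> periodic_placements V \<Gamma>"
    unfolding periodic_placements_iff using L \<pi>
    by (auto simp: p_def \<pi>_def intro!: exI[of _ L])
  moreover have "(\<lambda>i\<in>{1..<n}. matrix_inv L *v (p (v i) - p (v 0))) = t"
    using t by (intro extensionalityI[of _ "{1..<n}"]) (auto simp: PiE_def pv s_def matrix_inv_mult(4)[OF L])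
  then have "placement_parameters \<phi> n v (p, \<pi>) = y"
    unfolding placement_parameters_pair lattice_matrix_eqI[of \<pi>, OF \<pi>] yt LA by simp
  ultimately show ?thesis
    using that by blast
qed

text \<open>The parameters are constant on each nonempty class, so the image of a class is a
  singleton and \<open>the_elem\<close> extracts the induced value.\<close>

lemma bij_betw_parameters:
  "bij_betw (\<lambda>C. the_elem (placement_parameters \<phi> n v ` C))
    ((periodic_placements V \<Gamma> :: ('v, 'd) placement set) // placement_equiv V \<Gamma>)
    (parameter_space n)"
proof -
  let ?P = "periodic_placements V \<Gamma> :: ('v, 'd) placement set"
  let ?r = "placement_equiv V \<Gamma> :: (('v, 'd) placement \<times> _) set"
  let ?F = "\<lambda>C. the_elem (placement_parameters \<phi> n v ` C)"
  have F: "?F (?r `` {P}) = placement_parameters \<phi> n v P" if "P \<in> ?P" for P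
  proof -
    have "placement_parameters \<phi> n v Q = placement_parameters \<phi> n v P" if "Q \<in> ?r `` {P}" for Q
      using that placement_parameters_eqI[of P Q] by simp
    then have "placement_parameters \<phi> n v ` (?r `` {P}) = (\<lambda>_. placement_parameters \<phi> n v P) ` (?r `` {P})"
      by (rule image_cong[OF refl])
    also have "\<dots> = {placement_parameters \<phi> n v P}"
      by (rule image_constant[OF equiv_class_self[OF equiv_placement_equiv that]])
    finally have "placement_parameters \<phi> n v ` (?r `` {P}) = {placement_parameters \<phi> n v P}" .
    then show ?thesis
      by simp
  qed
  show ?thesis
  proof (rule bij_betwI')
    fix C D assume "C \<in> ?P // ?r" "D \<in> ?P // ?r"
    then obtain P Q where PQ: "P \<in> ?P" "Q \<in> ?P" and CD: "C = ?r `` {P}" "D = ?r `` {Q}"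
      unfolding quotient_def by blast
    show "?F C = ?F D \<longleftrightarrow> C = D"
      unfolding CD F[OF PQ(1)] F[OF PQ(2)]
      unfolding eq_equiv_class_iff[OF equiv_placement_equiv PQ]
      by (rule iffI[OF placement_equiv_of_parameters_eq[OF PQ] placement_parameters_eqI])
  next
    fix C assume "C \<in> ?P // ?r"
    then obtain P where P: "P \<in> ?P" and C: "C = ?r `` {P}"
      unfolding quotient_def by blast
    show "?F C \<in> parameter_space n"
      unfolding C F[OF P] by (rule placement_parameters_in[OF P])
  next
    fix y :: "(nat \<Rightarrow> real ^ 'd) \<times> (real ^ 'd ^ 'd)" assume "y \<in> parameter_space n"
    then obtain P where P: "P \<in> ?P" and y: "placement_parameters \<phi> n v P = y"
      by (rule placement_parameters_surj)
    show "\<exists>C \<in> ?P // ?r. y = ?F C"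
      using F[OF P] y quotientI[OF P] by (intro bexI[of _ "?r `` {P}"]) simp_all
  qed
qed

end

text \<open>The first three conjuncts give the fourth its meaning: \<open>matrix_inv\<close> is a
  true inverse, the classes form a partition, and the induced map is well defined. The last one
  makes openness precise through linear coordinates.\<close>

theorem proposition2:
  fixes V :: "'v set" and E :: "'v set set" and \<Gamma> :: "('v \<Rightarrow> 'v) set"
    and n :: nat and v :: "nat \<Rightarrow> 'v"
    and \<phi> :: "('d::finite \<Rightarrow>\<^sub>0 int) \<Rightarrow> 'v \<Rightarrow> 'v"
  assumes "periodic_graph CARD('d) V E \<Gamma>"
    and "n = card (vertex_orbits V \<Gamma>)"
    and "orbit_representatives V \<Gamma> n v"
    and "\<phi> \<in> iso (free_Abelian_group (UNIV :: 'd set)) (perm_group V \<Gamma>)"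
  shows "(\<forall>(p, \<pi>) \<in> (periodic_placements V \<Gamma> :: ('v, 'd) placement set).
            invertible (lattice_matrix \<phi> \<pi>)) \<and>
         equiv (periodic_placements V \<Gamma> :: ('v, 'd) placement set) (placement_equiv V \<Gamma>) \<and>
         placement_parameters \<phi> n v respects (placement_equiv V \<Gamma>) \<and>
         bij_betw (\<lambda>C. the_elem (placement_parameters \<phi> n v ` C))
           ((periodic_placements V \<Gamma> :: ('v, 'd) placement set) // placement_equiv V \<Gamma>)
           (parameter_space n) \<and>
         (\<exists>\<Phi> :: (nat \<Rightarrow> real ^ 'd) \<times> (real ^ 'd ^ 'd) \<Rightarrow> nat \<Rightarrow> real.
            linear_identification n (CARD('d) * n + (CARD('d) choose 2)) \<Phi> \<and>
            openin (Euclidean_space (CARD('d) * n + (CARD('d) choose 2)))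
              (\<Phi> ` parameter_space n))"
proof -
  interpret marked_graph V \<Gamma> n v \<phi>
  proof (rule marked_graph.intro)
    \<comment> \<open>An infinite vertex set has at least one orbit, and finiteness of the orbit set
      makes its cardinality n positive, so v 0 is a genuine representative.\<close>
    have "V \<noteq> {}"
      using assms(1) by (auto simp: periodic_graph_def)
    then have "vertex_orbits V \<Gamma> \<noteq> {}"
      by (simp add: vertex_orbits_def orbits_def)
    with assms(1,2) show "n > 0"
      by (simp add: periodic_graph_def card_gt_0_iff)
    show "subgroup \<Gamma> (BijGroup V)"
      using assms(1) unfolding periodic_graph_def by (elim conjE)
    show "\<gamma> = \<one>\<^bsub>BijGroup V\<^esub>" if "\<gamma> \<in> \<Gamma>" "x \<in> V" "\<gamma> x = x" for \<gamma> x
    proof -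
      have "\<forall>\<gamma>\<in>\<Gamma>. \<forall>x\<in>V. \<gamma> x = x \<longrightarrow> \<gamma> = \<one>\<^bsub>BijGroup V\<^esub>"
        using assms(1) unfolding periodic_graph_def by (elim conjE)
      with that show ?thesis
        by blast
    qed
  qed (fact assms(3,4))+
  have "\<forall>(p, \<pi>) \<in> (periodic_placements V \<Gamma> :: ('v, 'd) placement set). invertible (lattice_matrix \<phi> \<pi>)"
    using placementD(3) by blast
  moreover have "placement_parameters \<phi> n v respects (placement_equiv V \<Gamma>)"
    by (rule congruentI) (rule placement_parameters_eqI)
  ultimately show ?thesis
    using equiv_placement_equiv bij_betw_parameters parameter_space_identification[OF n_pos, where 'd = 'd]
    by (intro conjI)
qed

end
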